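(* Let $\rho:\mathbb{R}\to\mathbb{R}^+$ satisfy: (P1) $\rho(0)=0$ and $\rho$ is continuous at $0$; (P2) $\rho(-u)=\rho(u)$ for $u>0$; (P3) $\rho$ is nondecreasing on $u>0$; (P4) $\sup_u\rho(u)=a$ with $0<a<+\infty$. Let $0<b<a$. Let $\mathbf{Z}_n=(\mathbf{z}_1,\dots,\mathbf{z}_n)$, $\mathbf{z}_i=(y_i^*,\mathbf{x}_i,\delta_i)\in\mathbb{R}\times\mathbb{R}^p\times\{0,1\}$, be a censored regression sample such that $\{\mathbf{x}_1,\dots,\mathbf{x}_n\}$ has rank $p$. Put $$q=\max_{\|\theta\|=1}\#\{i:\theta'\mathbf{x}_i=0\},\qquad m=\#\{i:\delta_i=0\},$$ $$k_0=\min\left(n\left(1-\frac{b}{a}\right)-q-m,\; n\frac{b}{a}-m\right).$$ Let $\hat{\boldsymbol\beta}_n$ be the S-regression estimator for censored responses (defined in the context) based on $\rho$ and $b$. Then its finite-sample breakdown point satisfies $$\epsilon_n^*(\hat{\boldsymbol\beta}_n,\mathbf{Z}_n)\ \ge\ \frac{k_0}{n}.$$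
   Context: Samples. A censored regression sample of size $n$ is a list of $\mathbf{z}_i=(y_i^*,\mathbf{x}_i,\delta_i)$, $i=1,\dots,n$, with $y_i^*\in\mathbb{R}$, $\mathbf{x}_i\in\mathbb{R}^p$, and $\delta_i=1$ if the $i$th response is uncensored, $\delta_i=0$ if it is (right-)censored. Kaplan–Meier weights. For $\boldsymbol\beta\in\mathbb{R}^p$ let $r_i^*(\boldsymbol\beta)=y_i^*-\boldsymbol\beta'\mathbf{x}_i$. Let $F^*_{n\boldsymbol\beta}$ be the Kaplan–Meier (product-limit) estimator based on the pairs $(r_i^*(\boldsymbol\beta),\delta_i)$, where observations whose residual equals the largest residual are treated as uncensored (i.e. their $\delta_i$ is replaced by 1), so that $F^*_{n\boldsymbol\beta}$ is a probability distribution: $1-F^*_{n\boldsymbol\beta}(t)=\prod_{v\le t}(1-d(v)/N(v))$, the product being over the distinct uncensored residual values $v$, with $d(v)=\#\{j:\delta_j=1,r_j^*(\boldsymbol\beta)=v\}$ and $N(v)=\#\{j:r_j^*(\boldsymbol\beta)\ge v\}$. For $\delta_j=1$ let $\pi_j$ be the jump of $F^*_{n\boldsymbol\beta}$ at $r_j^*(\boldsymbol\beta)$ divided by $d(r_j^*(\boldsymbol\beta))$. For $\delta_i=0$ let $M_i=\{j:r_j^*(\boldsymbol\beta)>r_i^*(\boldsymbol\beta),\ \delta_j=1\}$. Set $$\pi_{\boldsymbol\beta,ij}=\begin{cases}\pi_j/\big(n\sum_{k\in M_i}\pi_k\big), & \delta_i=0,\ j\in M_i,\\ 1/n, & \delta_i=1,\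 i=j,\\ 0,&\text{otherwise.}\end{cases}$$ $H^*_{n\boldsymbol\beta}$ is the discrete distribution on $\mathbb{R}\times\mathbb{R}^p$ that puts mass $\pi_{\boldsymbol\beta,ij}$ at $(r_j^*(\boldsymbol\beta),\mathbf{x}_i)$; thus $E_{H^*_{n\boldsymbol\beta}}[g(u,\mathbf{x})]=\sum_{i,j}\pi_{\boldsymbol\beta,ij}\,g(r_j^*(\boldsymbol\beta),\mathbf{x}_i)$. S-estimator. For $\boldsymbol\beta,\boldsymbol\gamma\in\mathbb{R}^p$ the M-scale is $$S_n(\boldsymbol\beta,\boldsymbol\gamma)=\inf\{s>0:E_{H^*_{n\boldsymbol\beta}}[\rho((u-\boldsymbol\gamma'\mathbf{x})/s)]<b\}.$$ Let $\hat{\boldsymbol\gamma}_n(\boldsymbol\beta)$ be a minimizer of $\boldsymbol\gamma\mapsto S_n(\boldsymbol\beta,\boldsymbol\gamma)$ over $\mathbb{R}^p$. The S-regression estimator $\hat{\boldsymbol\beta}_n$ is a vector with $\hat{\boldsymbol\gamma}_n(\hat{\boldsymbol\beta}_n)=\mathbf{0}$; or, alternatively (to avoid existence problems), a minimizer over $\boldsymbol\beta\in\mathbb{R}^p$ of $\hat{\boldsymbol\gamma}_n(\boldsymbol\beta)'\mathbf{A}_n\hat{\boldsymbol\gamma}_n(\boldsymbol\beta)$, where $\mathbf{A}_n=\mathbf{A}_n(\mathbf{x}_1,\dots,\mathbf{x}_n)$ is a robust affine equivariant covariance estimator of the covariates. Here robust means: $\mathbf{A}_n$ is symmetric positive definite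 and its eigenvalues stay bounded away from $0$ and $\infty$ over all samples obtained from $\mathbf{Z}_n$ by replacing fewer than $k_0$ observations. The minimizers and the estimator are assumed to exist at the samples at which they are evaluated; the choice among several is arbitrary. Breakdown point. For an estimator $\mathbf{T}_n$, $$\epsilon_n^*(\mathbf{T}_n,\mathbf{Z}_n)=\min_{1\le k\le n}\{k/n:\sup\|\mathbf{T}_n(\mathbf{Z}^*_{k,n})-\mathbf{T}_n(\mathbf{Z}_n)\|=\infty\},$$ the supremum being over all samples $\mathbf{Z}^*_{k,n}$ obtained by replacing $k$ observations of $\mathbf{Z}_n$ by arbitrary values in $\mathbb{R}\times\mathbb{R}^p\times\{0,1\}$ (at which $\mathbf{T}_n$ is defined); the minimum of the empty set is $+\infty$, and $\|\cdot\|$ is the Euclidean norm. *)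

theory Defs
  imports "HOL-Analysis.Analysis"
begin

text \<open>
  An observation is a triple (response, covariates, censoring indicator); the indicator is
  True for an uncensored response. The index types 'n and 'p carry the sample size
  n = CARD('n) and the dimension p = CARD('p) of the covariates.
\<close>

type_synonym 'p obs = "real \<times> (real ^ 'p) \<times> bool"
type_synonym ('n, 'p) sample = "'n \<Rightarrow> 'p obs"

definition resp :: "('n, 'p) sample \<Rightarrow> 'n \<Rightarrow> real" where
  "resp Z i = fst (Z i)"

definition covar :: "('n, 'p) sample \<Rightarrow> 'n \<Rightarrow> real ^ 'p" where
  "covar Z i = fst (snd (Z i))"

definition uncens :: "('n, 'p) sample \<Rightarrow> 'n \<Rightarrow> bool" where
  "uncens Z i = snd (snd (Z i))"


subsection \<open>Kaplan--Meier weights\<close>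

definition resid :: "('n::finite, 'p::finite) sample \<Rightarrow> real ^ 'p \<Rightarrow> 'n \<Rightarrow> real" where
  "resid Z \<beta> i = resp Z i - \<beta> \<bullet> covar Z i"

text \<open>
  The indicator used in the weights: observations attaining the largest residual count as
  uncensored. It depends on \<open>\<beta>\<close>, and it replaces the original indicator both in the
  product-limit estimator and in the case distinction defining the weights.
\<close>

definition km_uncens :: "('n::finite, 'p::finite) sample \<Rightarrow> real ^ 'p \<Rightarrow> 'n \<Rightarrow> bool" where
  "km_uncens Z \<beta> i \<longleftrightarrow> uncens Z i \<or> resid Z \<beta> i = Max (range (resid Z \<beta>))"

definition km_deaths :: "('n::finite, 'p::finite) sample \<Rightarrow> real ^ 'p \<Rightarrow> real \<Rightarrow> nat" where
  "km_deaths Z \<beta> v = card {j. km_uncens Z \<beta> j \<and> resid Z \<beta> j = v}"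

definition km_at_risk :: "('n::finite, 'p::finite) sample \<Rightarrow> real ^ 'p \<Rightarrow> real \<Rightarrow> nat" where
  "km_at_risk Z \<beta> v = card {j. resid Z \<beta> j \<ge> v}"

definition km_cdf :: "('n::finite, 'p::finite) sample \<Rightarrow> real ^ 'p \<Rightarrow> real \<Rightarrow> real" where
  "km_cdf Z \<beta> t =
     1 - (\<Prod>v \<in> {v \<in> resid Z \<beta> ` {j. km_uncens Z \<beta> j}. v \<le> t}.
            1 - real (km_deaths Z \<beta> v) / real (km_at_risk Z \<beta> v))"

definition jump_at :: "(real \<Rightarrow> real) \<Rightarrow> real \<Rightarrow> real" where
  "jump_at F v = F v - Lim (at_left v) F"

definition km_jump :: "('n::finite, 'p::finite) sample \<Rightarrow> real ^ 'p \<Rightarrow> 'n \<Rightarrow> real" where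
  "km_jump Z \<beta> j =
     jump_at (km_cdf Z \<beta>) (resid Z \<beta> j) / real (km_deaths Z \<beta> (resid Z \<beta> j))"

definition km_later :: "('n::finite, 'p::finite) sample \<Rightarrow> real ^ 'p \<Rightarrow> 'n \<Rightarrow> 'n set" where
  "km_later Z \<beta> i = {j. resid Z \<beta> j > resid Z \<beta> i \<and> km_uncens Z \<beta> j}"

definition km_weight :: "('n::finite, 'p::finite) sample \<Rightarrow> real ^ 'p \<Rightarrow> 'n \<Rightarrow> 'n \<Rightarrow> real" where
  "km_weight Z \<beta> i j =
     (if \<not> km_uncens Z \<beta> i \<and> j \<in> km_later Z \<beta> i
        then km_jump Z \<beta> j / (real CARD('n) * (\<Sum>k \<in> km_later Z \<beta> i. km_jump Z \<beta> k))
      else if km_uncens Z \<beta> i \<and> i = j then 1 / real CARD('n)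
      else 0)"

text \<open>
  Expectation under the discrete distribution with mass \<open>km_weight Z \<beta> i j\<close> at the
  point (residual of j, covariates of i).
\<close>

definition km_expectation ::
  "('n::finite, 'p::finite) sample \<Rightarrow> real ^ 'p \<Rightarrow> (real \<Rightarrow> real ^ 'p \<Rightarrow> real) \<Rightarrow> real" where
  "km_expectation Z \<beta> g =
     (\<Sum>i \<in> UNIV. \<Sum>j \<in> UNIV. km_weight Z \<beta> i j * g (resid Z \<beta> j) (covar Z i))"


subsection \<open>The S-regression estimator\<close>

definition M_scale ::
  "(real \<Rightarrow> real) \<Rightarrow> real \<Rightarrow> ('n::finite, 'p::finite) sample \<Rightarrow> real ^ 'p \<Rightarrow> real ^ 'p \<Rightarrow> real" where
  "M_scale \<rho> b Z \<beta> \<gamma> =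
     Inf {s. s > 0 \<and> km_expectation Z \<beta> (\<lambda>u x. \<rho> ((u - \<gamma> \<bullet> x) / s)) < b}"

definition is_gamma_hat ::
  "(real \<Rightarrow> real) \<Rightarrow> real \<Rightarrow> ('n::finite, 'p::finite) sample \<Rightarrow> real ^ 'p \<Rightarrow> real ^ 'p \<Rightarrow> bool" where
  "is_gamma_hat \<rho> b Z \<beta> \<gamma> \<longleftrightarrow> is_arg_min (M_scale \<rho> b Z \<beta>) (\<lambda>_. True) \<gamma>"

text \<open>
  The two alternative definitions of the estimate at a sample Z. In both, the choice among
  several minimizers is arbitrary; in the second, the function g is such a choice, made for
  every \<open>\<beta>\<close>.
\<close>

definition is_S_regression_zero ::
  "(real \<Rightarrow> real) \<Rightarrow> real \<Rightarrow> ('n::finite, 'p::finite) sample \<Rightarrow> real ^ 'p \<Rightarrow> bool" where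
  "is_S_regression_zero \<rho> b Z \<beta> \<longleftrightarrow> is_gamma_hat \<rho> b Z \<beta> 0"

definition is_S_regression_min ::
  "(real \<Rightarrow> real) \<Rightarrow> real \<Rightarrow> (('n \<Rightarrow> real ^ 'p) \<Rightarrow> real ^ 'p ^ 'p)
    \<Rightarrow> ('n::finite, 'p::finite) sample \<Rightarrow> real ^ 'p \<Rightarrow> bool" where
  "is_S_regression_min \<rho> b A Z \<beta> \<longleftrightarrow>
     (\<exists>g. (\<forall>\<beta>'. is_gamma_hat \<rho> b Z \<beta>' (g \<beta>')) \<and>
          is_arg_min (\<lambda>\<beta>'. g \<beta>' \<bullet> (A (covar Z) *v g \<beta>')) (\<lambda>_. True) \<beta>)"


subsection \<open>Contaminated samples and breakdown point\<close>

definition replacements :: "nat \<Rightarrow> ('n::finite, 'p) sample \<Rightarrow> ('n, 'p) sample set" where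
  "replacements k Z = {Z'. \<exists>I. card I = k \<and> (\<forall>i. i \<notin> I \<longrightarrow> Z' i = Z i)}"

text \<open>
  D is the set of samples at which the estimator T is defined. The supremum and the minimum
  are taken in the extended reals, so that \<open>Inf {} = \<infinity>\<close>.
\<close>

definition breakdown_point ::
  "('n::finite, 'p::finite) sample set \<Rightarrow> (('n, 'p) sample \<Rightarrow> real ^ 'p) \<Rightarrow> ('n, 'p) sample \<Rightarrow> ereal"
  where
  "breakdown_point D T Z =
     Inf {ereal (real k / real CARD('n)) | k. 1 \<le> k \<and> k \<le> CARD('n) \<and>
            (SUP Z' \<in> replacements k Z \<inter> D. ereal (norm (T Z' - T Z))) = \<infinity>}"


subsection \<open>Robust affine equivariant covariance estimators\<close>

definition affine_equivariant ::
  "(('n \<Rightarrow> real ^ 'p) \<Rightarrow> real ^ 'p ^ 'p::finite) \<Rightarrow> bool" where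
  "affine_equivariant A \<longleftrightarrow>
     (\<forall>x C d. invertible C \<longrightarrow> A (\<lambda>i. C *v x i + d) = C ** A x ** transpose C)"

definition positive_definite :: "real ^ 'p ^ 'p::finite \<Rightarrow> bool" where
  "positive_definite M \<longleftrightarrow> (\<forall>v. v \<noteq> 0 \<longrightarrow> v \<bullet> (M *v v) > 0)"

definition eigenvalue :: "real ^ 'p ^ 'p::finite \<Rightarrow> real \<Rightarrow> bool" where
  "eigenvalue M l \<longleftrightarrow> (\<exists>v. v \<noteq> 0 \<and> M *v v = l *\<^sub>R v)"

definition robust_covariance ::
  "real \<Rightarrow> ('n::finite, 'p::finite) sample \<Rightarrow> (('n \<Rightarrow> real ^ 'p) \<Rightarrow> real ^ 'p ^ 'p) \<Rightarrow> bool" where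
  "robust_covariance k0 Z A \<longleftrightarrow>
     (\<exists>lo hi. 0 < lo \<and>
        (\<forall>k. \<forall>Z' \<in> replacements k Z. real k < k0 \<longrightarrow>
           transpose (A (covar Z')) = A (covar Z') \<and>
           positive_definite (A (covar Z')) \<and>
           (\<forall>l. eigenvalue (A (covar Z')) l \<longrightarrow> lo \<le> l \<and> l \<le> hi)))"

end

theory Submission
  imports Defs
begin

text \<open>
  The redistribution of mass in the Kaplan--Meier construction concerns censored observations
  only: an uncensored observation \<open>i\<close> keeps mass \<open>1/n\<close> at its own point, while every censored
  one spreads mass at most \<open>1/n\<close>. Replace \<open>k < k\<^sub>0\<close> observations and call an observation kept if it
  is uncensored and was not replaced; at most \<open>k + m\<close> observations are not kept. The residual
  that a kept observation contributes to \<open>S(\<beta>, \<gamma>)\<close> is \<open>y\<^sub>i - (\<beta> + \<gamma>)'x\<^sub>i\<close>, computed from the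
  original data and depending on \<open>\<beta> + \<gamma>\<close> only. Two estimates follow, uniform over all such
  contaminations and over \<open>\<beta>\<close>.

  \<^item> For \<open>\<gamma> = -\<beta>\<close> the kept residuals are the original responses, hence negligible after division
    by a large scale, and the other observations contribute at most \<open>a (k + m) / n < b\<close>. So
    \<open>S(\<beta>, -\<beta>)\<close> is bounded by a constant \<open>K\<close> (\<open>M_scale_uniformly_bounded\<close>).

  \<^item> By compactness of the sphere, all but \<open>q\<close> covariates stay at a fixed distance from any given
    hyperplane through the origin (\<open>few_covariates_near_hyperplane\<close>). If \<open>\<beta> + \<gamma>\<close> is large, then at
    least \<open>n - q - k - m\<close> kept residuals are large, and as \<open>a (n - q - k - m) / n > b\<close>, the scale
    \<open>S(\<beta>, \<gamma>)\<close> exceeds \<open>K\<close> (\<open>M_scale_uniformly_large\<close>).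

  A minimizer \<open>\<gamma>\<close> of \<open>S(\<beta>, \<cdot>)\<close> does no worse than \<open>-\<beta>\<close>, so \<open>\<beta> + \<gamma>\<close> is bounded by some \<open>R\<close>
  (\<open>gamma_hat_uniformly_close\<close>). If the estimator is defined by \<open>\<gamma> = 0\<close>, this bounds it at once.
  If it minimizes the quadratic form of \<open>A\<close> at \<open>\<gamma>(\<beta>)\<close>, compare it with \<open>\<beta> = 0\<close>, where
  \<open>\<parallel>\<gamma>(0)\<parallel> \<le> R\<close>; the bounds on the eigenvalues of \<open>A\<close> then bound \<open>\<gamma>(\<beta>)\<close>, and hence \<open>\<beta>\<close>
  (\<open>S_regression_min_norm_le\<close>).
\<close>


section \<open>Rayleigh bounds for symmetric matrices\<close>

text \<open>
  A minimizer \<open>v\<close> of the quadratic form on the unit sphere is an eigenvector: with \<open>l\<close> the minimum,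
  the form \<open>w \<bullet> (M w) - l (w \<bullet> w)\<close> is nonnegative and vanishes at \<open>v\<close>, so its derivative at \<open>v\<close> in
  every direction vanishes.
\<close>

lemma symmetric_matrix_least_eigenvalue:
  fixes M :: "real ^ 'p ^ 'p::finite"
  assumes sym: "transpose M = M"
  obtains l where "eigenvalue M l" and "\<And>w. l * (w \<bullet> w) \<le> w \<bullet> (M *v w)"
proof -
  let ?Q = "\<lambda>w::real ^ 'p. w \<bullet> (M *v w)"
  have "sphere (0::real ^ 'p) 1 \<noteq> {}"
    by simp
  moreover have "continuous_on (sphere 0 1) ?Q"
    by (intro continuous_intros linear_continuous_on matrix_vector_mul_bounded_linear)
  ultimately obtain v where v: "v \<in> sphere 0 1" and v_min: "\<And>w. w \<in> sphere 0 1 \<Longrightarrow> ?Q v \<le> ?Q w"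
    using continuous_attains_inf[of "sphere 0 1" ?Q] by auto
  define l where "l = ?Q v"
  have vv: "v \<bullet> v = 1" and "v \<noteq> 0"
    using v by (auto simp: dot_square_norm)
  have bound: "l * (w \<bullet> w) \<le> ?Q w" for w
  proof (cases "w = 0")
    case False
    let ?u = "(1 / norm w) *\<^sub>R w"
    have "l \<le> ?Q ?u"
      unfolding l_def by (rule v_min) (simp add: False)
    also have "\<dots> = ?Q w / (norm w)\<^sup>2"
      by (simp add: matrix_vector_mult_scaleR power2_eq_square)
    finally show ?thesis
      using False by (simp add: field_simps power2_norm_eq_inner)
  qed simp
  have swap: "v \<bullet> (M *v w) = w \<bullet> (M *v v)" for w
    using sym by (metis dot_lmul_matrix inner_commute transpose_matrix_vector)
  have "w \<bullet> (M *v v - l *\<^sub>R v) = 0" for w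
  proof -
    define p where "p = w \<bullet> (M *v v - l *\<^sub>R v)"
    define r where "r = ?Q w - l * (w \<bullet> w)"
    have quad: "0 \<le> 2 * t * p + t\<^sup>2 * r" for t
    proof -
      have "0 \<le> ?Q (v + t *\<^sub>R w) - l * ((v + t *\<^sub>R w) \<bullet> (v + t *\<^sub>R w))"
        using bound by simp
      also have "\<dots> = 2 * t * p + t\<^sup>2 * r"
        unfolding p_def r_def
        by (simp add: matrix_vector_right_distrib matrix_vector_mult_scaleR inner_add_left
            inner_add_right inner_diff_right swap[of w] vv l_def[symmetric] inner_commute[of v w])
          (simp add: power2_eq_square algebra_simps)
      finally show ?thesis .
    qed
    have "0 \<le> r"
      unfolding r_def using bound by simp
    \<comment> \<open>at this t the quadratic is at most \<open>- p\<^sup>2 / (r + 1)\<close>\<close>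
    have "0 \<le> 2 * (- p / (r + 1)) * p + (- p / (r + 1))\<^sup>2 * r"
      by (rule quad)
    also have "\<dots> = - (p\<^sup>2 * (r + 2)) / (r + 1)\<^sup>2"
      using \<open>0 \<le> r\<close> by (simp add: divide_simps power2_eq_square) (simp add: algebra_simps)
    finally have "p\<^sup>2 * (r + 2) \<le> 0"
      using \<open>0 \<le> r\<close> by (auto simp: divide_le_0_iff)
    then show ?thesis
      using \<open>0 \<le> r\<close> by (simp add: p_def[symmetric] mult_le_0_iff)
  qed
  then have "M *v v = l *\<^sub>R v"
    by (metis inner_eq_zero_iff right_minus_eq)
  then have "eigenvalue M l"
    unfolding eigenvalue_def using \<open>v \<noteq> 0\<close> by blast
  then show thesis
    using bound that by blast
qed

text \<open>The upper bound is the lower bound for the matrix \<open>- M\<close>.\<close>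

lemma symmetric_matrix_quadratic_form_bounds:
  fixes M :: "real ^ 'p ^ 'p::finite"
  assumes sym: "transpose M = M"
    and eig: "\<And>l. eigenvalue M l \<Longrightarrow> lo \<le> l \<and> l \<le> hi"
  shows "lo * (norm v)\<^sup>2 \<le> v \<bullet> (M *v v)" and "v \<bullet> (M *v v) \<le> hi * (norm v)\<^sup>2"
proof -
  obtain l where l: "eigenvalue M l" "l * (v \<bullet> v) \<le> v \<bullet> (M *v v)"
    using symmetric_matrix_least_eigenvalue[OF sym] by metis
  have "lo * (v \<bullet> v) \<le> l * (v \<bullet> v)"
    using eig[OF l(1)] by (intro mult_right_mono) auto
  with l(2) show "lo * (norm v)\<^sup>2 \<le> v \<bullet> (M *v v)"
    by (simp add: power2_norm_eq_inner)
  have neg: "(- M) *v w = - (M *v w)" for w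
    by (simp add: vec_eq_iff matrix_vector_mult_def sum_negf)
  have "transpose (- M) = - M"
    using sym by (simp add: vec_eq_iff transpose_def)
  then obtain u where u: "eigenvalue (- M) u" "u * (v \<bullet> v) \<le> v \<bullet> (- M *v v)"
    using symmetric_matrix_least_eigenvalue by metis
  have "eigenvalue M (- u)"
    using u(1) unfolding eigenvalue_def neg by (metis minus_minus scaleR_minus_left)
  then have "- u * (v \<bullet> v) \<le> hi * (v \<bullet> v)"
    using eig by (intro mult_right_mono) auto
  with u(2) show "v \<bullet> (M *v v) \<le> hi * (norm v)\<^sup>2"
    by (simp add: power2_norm_eq_inner neg)
qed


section \<open>The Kaplan--Meier weights\<close>

text \<open>
  Just to the left of a residual \<open>v\<close> the Kaplan--Meier step function is constant, with value the
  product over the uncensored residuals below \<open>v\<close>; passing \<open>v\<close> multiplies the product by factors in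
  \<open>[0, 1]\<close>.
\<close>

lemma km_jump_nonneg: "0 \<le> km_jump Z \<beta> j"
proof -
  let ?v = "resid Z \<beta> j"
  let ?V = "resid Z \<beta> ` {j. km_uncens Z \<beta> j}"
  define f where "f w = 1 - real (km_deaths Z \<beta> w) / real (km_at_risk Z \<beta> w)" for w
  have cdf: "km_cdf Z \<beta> t = 1 - prod f {w \<in> ?V. w \<le> t}" for t
    by (simp add: km_cdf_def f_def)
  have "km_deaths Z \<beta> w \<le> km_at_risk Z \<beta> w" for w
    unfolding km_deaths_def km_at_risk_def by (intro card_mono) auto
  then have f01: "0 \<le> f w" "f w \<le> 1" for w
    by (auto simp: f_def divide_le_eq_1)
  have "\<forall>w\<in>?V. \<forall>\<^sub>F t in at_left ?v. w \<le> t \<longleftrightarrow> w < ?v"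
  proof
    fix w
    show "\<forall>\<^sub>F t in at_left ?v. w \<le> t \<longleftrightarrow> w < ?v"
    proof (cases "w < ?v")
      case True
      then show ?thesis
        using eventually_at_left_real[OF True] by (auto elim: eventually_mono)
    next
      case False
      have "\<forall>\<^sub>F t in at_left ?v. t < ?v"
        by (simp add: eventually_at_filter)
      then show ?thesis
        using False by (auto elim!: eventually_mono)
    qed
  qed
  then have "\<forall>\<^sub>F t in at_left ?v. \<forall>w\<in>?V. w \<le> t \<longleftrightarrow> w < ?v"
    by (intro eventually_ball_finite) auto
  then have "\<forall>\<^sub>F t in at_left ?v. km_cdf Z \<beta> t = 1 - prod f {w \<in> ?V. w < ?v}"
    by eventually_elim (auto simp: cdf intro!: prod.cong)
  then have "(km_cdf Z \<beta> \<longlongrightarrow> 1 - prod f {w \<in> ?V. w < ?v}) (at_left ?v)"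
    by (rule tendsto_eventually)
  then have left_limit: "Lim (at_left ?v) (km_cdf Z \<beta>) = 1 - prod f {w \<in> ?V. w < ?v}"
    by (intro tendsto_Lim) auto
  have "prod f {w \<in> ?V. w \<le> ?v} =
      prod f ({w \<in> ?V. w \<le> ?v} - {w \<in> ?V. w < ?v}) * prod f {w \<in> ?V. w < ?v}"
    by (intro prod.subset_diff) auto
  also have "\<dots> \<le> 1 * prod f {w \<in> ?V. w < ?v}"
    using f01 by (intro mult_right_mono prod_le_1 prod_nonneg) auto
  finally have "0 \<le> jump_at (km_cdf Z \<beta>) ?v"
    by (simp add: jump_at_def cdf left_limit)
  then show ?thesis
    by (simp add: km_jump_def)
qed

lemma km_weight_nonneg: "0 \<le> km_weight Z \<beta> i j"
  unfolding km_weight_def by (auto intro!: divide_nonneg_nonneg mult_nonneg_nonneg sum_nonneg km_jump_nonneg)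

lemma km_weight_uncens:
  fixes Z :: "('n::finite, 'p::finite) sample"
  assumes "uncens Z i"
  shows "km_weight Z \<beta> i j = (if i = j then 1 / real CARD('n) else 0)"
  using assms by (simp add: km_weight_def km_uncens_def)

text \<open>
  Equality holds except for a censored observation whose later jumps sum to zero: division by zero
  then makes its row of weights zero.
\<close>

lemma sum_km_weight_le:
  fixes Z :: "('n::finite, 'p::finite) sample"
  shows "(\<Sum>j\<in>UNIV. km_weight Z \<beta> i j) \<le> 1 / real CARD('n)"
proof (cases "km_uncens Z \<beta> i")
  case True
  then show ?thesis
    by (simp add: km_weight_def)
next
  case False
  define s where "s = (\<Sum>k\<in>km_later Z \<beta> i. km_jump Z \<beta> k)"
  have "(\<Sum>j\<in>UNIV. km_weight Z \<beta> i j) =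
      (\<Sum>j\<in>km_later Z \<beta> i. km_jump Z \<beta> j / (real CARD('n) * s))"
    using False by (intro sum.mono_neutral_cong_right) (auto simp: km_weight_def s_def)
  also have "\<dots> = s / (real CARD('n) * s)"
    by (simp add: s_def sum_divide_distrib)
  also have "\<dots> \<le> 1 / real CARD('n)"
    by (cases "s = 0") auto
  finally show ?thesis .
qed

lemma uncens_sum_le_km_expectation:
  fixes Z :: "('n::finite, 'p::finite) sample"
  assumes G: "\<And>i. i \<in> G \<Longrightarrow> uncens Z i"
    and g: "\<And>u x. 0 \<le> g u x"
  shows "(\<Sum>i\<in>G. g (resid Z \<beta> i) (covar Z i)) / real CARD('n) \<le> km_expectation Z \<beta> g"
proof -
  let ?row = "\<lambda>i. \<Sum>j\<in>UNIV. km_weight Z \<beta> i j * g (resid Z \<beta> j) (covar Z i)"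
  have "(\<Sum>i\<in>G. g (resid Z \<beta> i) (covar Z i)) / real CARD('n) = sum ?row G"
    unfolding sum_divide_distrib
    by (intro sum.cong) (simp_all add: km_weight_uncens G if_distrib[of "\<lambda>w. w * _"] cong: if_cong)
  also have "\<dots> \<le> sum ?row UNIV"
    by (intro sum_mono2 sum_nonneg mult_nonneg_nonneg km_weight_nonneg g) auto
  finally show ?thesis
    by (simp add: km_expectation_def)
qed

lemma km_expectation_le:
  fixes Z :: "('n::finite, 'p::finite) sample"
  assumes G: "\<And>i. i \<in> G \<Longrightarrow> uncens Z i"
    and g: "\<And>u x. g u x \<le> a" and a: "0 \<le> a"
  shows "km_expectation Z \<beta> g \<le>
    ((\<Sum>i\<in>G. g (resid Z \<beta> i) (covar Z i)) + a * real (card (- G))) / real CARD('n)"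
proof -
  let ?row = "\<lambda>i. \<Sum>j\<in>UNIV. km_weight Z \<beta> i j * g (resid Z \<beta> j) (covar Z i)"
  have "km_expectation Z \<beta> g = sum ?row (G \<union> - G)"
    by (simp add: km_expectation_def)
  also have "\<dots> = sum ?row G + sum ?row (- G)"
    by (intro sum.union_disjoint) auto
  also have "sum ?row G = (\<Sum>i\<in>G. g (resid Z \<beta> i) (covar Z i)) / real CARD('n)"
    unfolding sum_divide_distrib
    by (intro sum.cong) (simp_all add: km_weight_uncens G if_distrib[of "\<lambda>w. w * _"] cong: if_cong)
  also have "sum ?row (- G) \<le> (\<Sum>i\<in>- G. a / real CARD('n))"
  proof (rule sum_mono)
    fix i
    have "?row i \<le> (\<Sum>j\<in>UNIV. km_weight Z \<beta> i j * a)"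
      by (intro sum_mono mult_left_mono km_weight_nonneg g)
    also have "\<dots> \<le> 1 / real CARD('n) * a"
      unfolding sum_distrib_right[symmetric] using sum_km_weight_le a by (intro mult_right_mono) auto
    finally show "?row i \<le> a / real CARD('n)"
      by simp
  qed
  finally show ?thesis
    by (simp add: add_divide_distrib mult.commute)
qed


section \<open>The M-scale for a bounded loss function\<close>

locale bounded_loss =
  fixes \<rho> :: "real \<Rightarrow> real" and a :: real
  assumes nonneg: "0 \<le> \<rho> u"
    and at_0: "\<rho> 0 = 0"
    and cont_0: "isCont \<rho> 0"
    and even_pos: "u > 0 \<Longrightarrow> \<rho> (- u) = \<rho> u"
    and mono_pos: "mono_on {0<..} \<rho>"
    and sup: "(SUP u. ereal (\<rho> u)) = ereal a"
    and a_pos: "0 < a"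
begin

lemma le_a: "\<rho> u \<le> a"
  using SUP_upper[of u UNIV "\<lambda>u. ereal (\<rho> u)"] by (simp add: sup)

lemma abs_eq: "\<rho> \<bar>u\<bar> = \<rho> u"
  using even_pos[of "- u"] by (cases "u < 0") (auto simp: abs_if)

lemma mono_abs: "\<bar>u\<bar> \<le> \<bar>v\<bar> \<Longrightarrow> \<rho> u \<le> \<rho> v"
  using mono_onD[OF mono_pos, of "\<bar>u\<bar>" "\<bar>v\<bar>"] nonneg[of v]
  by (cases "u = 0") (auto simp: abs_eq at_0)

text \<open>Symmetry and monotonicity turn a single value above \<open>d\<close> into values above \<open>d\<close> on both tails.\<close>

lemma exceeds_below_sup:
  assumes "d < a"
  obtains M where "0 \<le> M" and "\<And>u. M \<le> \<bar>u\<bar> \<Longrightarrow> d < \<rho> u"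
proof -
  have "ereal d < (SUP u. ereal (\<rho> u))"
    using assms by (simp add: sup)
  then obtain w where "d < \<rho> w"
    by (auto simp: less_SUP_iff)
  then have "d < \<rho> u" if "\<bar>w\<bar> \<le> \<bar>u\<bar>" for u
    using mono_abs[OF that] by simp
  then show thesis
    using that[of "\<bar>w\<bar>"] by auto
qed

lemma tendsto_scaled: "((\<lambda>s. \<rho> (c / s)) \<longlongrightarrow> 0) at_top"
proof -
  have "((\<lambda>s. c / s) \<longlongrightarrow> 0) at_top"
    by (rule tendsto_divide_0[OF tendsto_const filterlim_at_top_imp_at_infinity[OF filterlim_ident]])
  then show ?thesis
    using isCont_tendsto_compose[OF cont_0] by (simp add: at_0)
qed

lemma M_scale_le:
  assumes "0 < s" and "km_expectation Z \<beta> (\<lambda>u x. \<rho> ((u - \<gamma> \<bullet> x) / s)) < b"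
  shows "M_scale \<rho> b Z \<beta> \<gamma> \<le> s"
  unfolding M_scale_def using assms by (intro cInf_lower) (auto intro!: bdd_belowI[of _ 0])

text \<open>
  The infimum is over a nonempty set: at a fixed sample the expectation is a finite sum, each term
  of which tends to zero as the scale grows.
\<close>

lemma le_M_scale:
  assumes "0 < b"
    and "\<And>s. 0 < s \<Longrightarrow> s \<le> L \<Longrightarrow> b \<le> km_expectation Z \<beta> (\<lambda>u x. \<rho> ((u - \<gamma> \<bullet> x) / s))"
  shows "L \<le> M_scale \<rho> b Z \<beta> \<gamma>"
proof -
  let ?E = "\<lambda>s. km_expectation Z \<beta> (\<lambda>u x. \<rho> ((u - \<gamma> \<bullet> x) / s))"
  have "(?E \<longlongrightarrow> (\<Sum>i\<in>UNIV. \<Sum>j\<in>UNIV. km_weight Z \<beta> i j * 0)) at_top"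
    unfolding km_expectation_def by (intro tendsto_intros tendsto_scaled)
  then have "\<forall>\<^sub>F s in at_top. ?E s < b"
    using \<open>0 < b\<close> by (intro order_tendstoD) auto
  then have "\<forall>\<^sub>F s in at_top. s > 0 \<and> ?E s < b"
    using eventually_gt_at_top by (intro eventually_conj)
  then have "{s. s > 0 \<and> ?E s < b} \<noteq> {}"
    using eventually_happens'[OF trivial_limit_at_top_linorder] by blast
  then show ?thesis
    unfolding M_scale_def using assms(2) by (intro cInf_greatest) (auto simp: not_less[symmetric] intro: less_imp_le)
qed

end


section \<open>Observations kept under contamination\<close>

text \<open>
  The estimates below see the contaminated sample only through such a set \<open>G\<close>. Replaced and
  censored observations are equally harmful to them, so \<open>r\<close> counts both.
\<close>

definition kept :: "nat \<Rightarrow> ('n::finite, 'p::finite) sample \<Rightarrow> ('n, 'p) sample \<Rightarrow> 'n set \<Rightarrow> bool" where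
  "kept r Z Z' G \<longleftrightarrow> (\<forall>i\<in>G. Z' i = Z i \<and> uncens Z i) \<and> CARD('n) \<le> card G + r"

lemma replacements_kept:
  assumes "Z' \<in> replacements k Z"
  shows "\<exists>G. kept (k + card {i. \<not> uncens Z i}) Z Z' G"
proof -
  obtain I where I: "card I = k" "\<And>i. i \<notin> I \<Longrightarrow> Z' i = Z i"
    using assms by (auto simp: replacements_def)
  let ?B = "I \<union> {i. \<not> uncens Z i}"
  have "CARD('a) = card (- ?B) + card ?B"
    by (metis Compl_eq_Diff_UNIV card_Diff_subset card_mono finite subset_UNIV le_add_diff_inverse2)
  moreover have "card ?B \<le> k + card {i. \<not> uncens Z i}"
    using card_Un_le[of I "{i. \<not> uncens Z i}"] I(1) by simp
  ultimately have "kept (k + card {i. \<not> uncens Z i}) Z Z' (- ?B)"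
    using I(2) by (auto simp: kept_def)
  then show ?thesis ..
qed

lemma kept_uncens: "kept r Z Z' G \<Longrightarrow> i \<in> G \<Longrightarrow> uncens Z' i"
  by (auto simp: kept_def uncens_def)

text \<open>
  On kept observations the dependence on \<open>\<beta>\<close> and \<open>\<gamma>\<close> is through \<open>\<beta> + \<gamma>\<close> alone, and the contaminated
  sample has disappeared; this is what makes the bounds below uniform.
\<close>

lemma kept_resid:
  "kept r Z Z' G \<Longrightarrow> i \<in> G \<Longrightarrow>
    resid Z' \<beta> i - \<gamma> \<bullet> covar Z' i = resp Z i - (\<beta> + \<gamma>) \<bullet> covar Z i"
  by (simp add: kept_def resid_def resp_def covar_def inner_add_left)

text \<open>
  If \<open>J\<close> has more than \<open>q\<close> elements, no direction is orthogonal to all \<open>x\<^sub>i\<close> with \<open>i \<in> J\<close>, so the sum of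
  \<open>\<bar>\<theta> \<bullet> x\<^sub>i\<bar>\<close> over \<open>J\<close> has a positive minimum on the sphere and one of its terms is bounded below
  for all \<open>\<theta>\<close>. As there are finitely many \<open>J\<close>, one constant serves all of them.
\<close>

lemma few_covariates_near_hyperplane:
  fixes x :: "'n::finite \<Rightarrow> real ^ 'p::finite"
  assumes q: "\<And>\<theta>. norm \<theta> = 1 \<Longrightarrow> card {i. \<theta> \<bullet> x i = 0} \<le> q"
  obtains c where "0 < c" and "\<And>\<theta>. norm \<theta> = 1 \<Longrightarrow> card {i. \<bar>\<theta> \<bullet> x i\<bar> < c} \<le> q"
proof -
  let ?P = "\<lambda>c J. \<forall>\<theta>. norm \<theta> = 1 \<longrightarrow> (\<exists>i\<in>J. c \<le> \<bar>\<theta> \<bullet> x i\<bar>)"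
  have "\<forall>J\<in>{J. q < card J}. \<forall>\<^sub>F c in at_right 0. ?P c J"
  proof
    fix J :: "'n set"
    assume J: "J \<in> {J. q < card J}"
    let ?f = "\<lambda>\<theta>. \<Sum>i\<in>J. \<bar>\<theta> \<bullet> x i\<bar>"
    have "sphere (0::real ^ 'p) 1 \<noteq> {}"
      by simp
    moreover have "continuous_on (sphere 0 1) ?f"
      by (intro continuous_intros)
    ultimately obtain v where v: "v \<in> sphere 0 1" and v_min: "\<And>\<theta>. \<theta> \<in> sphere 0 1 \<Longrightarrow> ?f v \<le> ?f \<theta>"
      using continuous_attains_inf[of "sphere 0 1" ?f] by auto
    have "0 < ?f v"
    proof (rule ccontr)
      assume "\<not> 0 < ?f v"
      then have "?f v = 0"
        by (meson abs_ge_zero not_less order.antisym sum_nonneg)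
      then have "J \<subseteq> {i. v \<bullet> x i = 0}"
        by (auto simp: sum_nonneg_eq_0_iff)
      then have "card J \<le> q"
        using q[of v] v card_mono[of "{i. v \<bullet> x i = 0}" J] by simp
      then show False
        using J by simp
    qed
    define c0 where "c0 = ?f v / real CARD('n)"
    have "0 < c0"
      using \<open>0 < ?f v\<close> by (simp add: c0_def)
    have "?P c J" if "c \<le> c0" "0 < c" for c
    proof (intro allI impI, rule ccontr)
      fix \<theta> :: "real ^ 'p"
      assume \<theta>: "norm \<theta> = 1" and "\<not> (\<exists>i\<in>J. c \<le> \<bar>\<theta> \<bullet> x i\<bar>)"
      then have "?f \<theta> < (\<Sum>i\<in>J. c)"
        using J by (intro sum_strict_mono) (auto simp: card_gt_0_iff)
      also have "\<dots> \<le> real CARD('n) * c0"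
        using that by (auto intro!: mult_mono card_mono)
      also have "\<dots> = ?f v"
        by (simp add: c0_def)
      finally show False
        using v_min[of \<theta>] \<theta> by simp
    qed
    then show "\<forall>\<^sub>F c in at_right 0. ?P c J"
      using eventually_at_right_real[OF \<open>0 < c0\<close>] by (auto elim!: eventually_mono)
  qed
  then have "\<forall>\<^sub>F c in at_right (0::real). \<forall>J\<in>{J. q < card J}. ?P c J"
    by (intro eventually_ball_finite) auto
  then have "\<forall>\<^sub>F c in at_right (0::real). 0 < c \<and> (\<forall>J\<in>{J. q < card J}. ?P c J)"
    by (intro eventually_conj) (auto simp: eventually_at_filter)
  then have "\<exists>c. 0 < c \<and> (\<forall>J\<in>{J. q < card J}. ?P c J)"
    by (rule eventually_happens'[OF trivial_limit_at_right_real])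
  then obtain c where c: "0 < c" "\<forall>J\<in>{J. q < card J}. ?P c J"
    by (elim exE conjE)
  have "card {i. \<bar>\<theta> \<bullet> x i\<bar> < c} \<le> q" if "norm \<theta> = 1" for \<theta>
  proof (rule ccontr)
    assume "\<not> card {i. \<bar>\<theta> \<bullet> x i\<bar> < c} \<le> q"
    then have "\<exists>i\<in>{i. \<bar>\<theta> \<bullet> x i\<bar> < c}. c \<le> \<bar>\<theta> \<bullet> x i\<bar>"
      using c(2) that by (simp only: mem_Collect_eq not_le Ball_def)
    then show False
      by simp
  qed
  then show thesis
    using c(1) that by blast
qed


section \<open>Uniform bounds under contamination\<close>

context bounded_loss
begin

lemma M_scale_uniformly_bounded:
  fixes Z :: "('n::finite, 'p::finite) sample"
  assumes r: "real r * a < real CARD('n) * b"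
  obtains K where "0 < K" and "\<And>Z' G \<beta>. kept r Z Z' G \<Longrightarrow> M_scale \<rho> b Z' \<beta> (- \<beta>) \<le> K"
proof -
  define Y where "Y = Max (range (\<lambda>i. \<bar>resp Z i\<bar>))"
  have Y: "\<bar>resp Z i\<bar> \<le> Y" for i
    unfolding Y_def by (intro Max_ge) auto
  \<comment> \<open>the margin left below \<open>b\<close> when every observation that is not kept contributes \<open>a / n\<close>\<close>
  define e where "e = (real CARD('n) * b - real r * a) / real CARD('n)"
  have "0 < e"
    using r by (simp add: e_def)
  have "\<forall>\<^sub>F s in at_top. 0 < s \<and> \<rho> (Y / s) < e"
    using \<open>0 < e\<close> by (intro eventually_conj eventually_gt_at_top order_tendstoD[OF tendsto_scaled])
  then obtain K where K: "0 < K" "\<rho> (Y / K) < e"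
    using eventually_happens'[OF trivial_limit_at_top_linorder] by blast
  have "M_scale \<rho> b Z' \<beta> (- \<beta>) \<le> K" if G: "kept r Z Z' G" for Z' G \<beta>
  proof (rule M_scale_le)
    let ?g = "\<lambda>u x. \<rho> ((u - (- \<beta>) \<bullet> x) / K)"
    have "?g (resid Z' \<beta> i) (covar Z' i) \<le> \<rho> (Y / K)" if "i \<in> G" for i
      unfolding kept_resid[OF G that] using Y[of i] \<open>0 < K\<close>
      by (intro mono_abs) (simp add: divide_right_mono)
    then have "(\<Sum>i\<in>G. ?g (resid Z' \<beta> i) (covar Z' i)) \<le> real (card G) * \<rho> (Y / K)"
      by (rule sum_bounded_above)
    also have "\<dots> \<le> real CARD('n) * \<rho> (Y / K)"
      by (intro mult_right_mono nonneg) (simp add: card_mono)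
    also have "\<dots> < real CARD('n) * e"
      using K(2) by simp
    finally have sum_G: "(\<Sum>i\<in>G. ?g (resid Z' \<beta> i) (covar Z' i)) < real CARD('n) * e" .
    have "card (- G) \<le> r"
      using G by (auto simp: kept_def Compl_eq_Diff_UNIV card_Diff_subset)
    then have "a * real (card (- G)) \<le> real r * a"
      using a_pos by simp
    with sum_G have "((\<Sum>i\<in>G. ?g (resid Z' \<beta> i) (covar Z' i)) + a * real (card (- G)))
        < real CARD('n) * b"
      by (simp add: e_def)
    then have "((\<Sum>i\<in>G. ?g (resid Z' \<beta> i) (covar Z' i)) + a * real (card (- G))) / real CARD('n) < b"
      by (simp add: divide_less_eq mult.commute)
    moreover have "km_expectation Z' \<beta> ?g
        \<le> ((\<Sum>i\<in>G. ?g (resid Z' \<beta> i) (covar Z' i)) + a * real (card (- G))) / real CARD('n)"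
      by (rule km_expectation_le) (use a_pos in \<open>auto simp: le_a kept_uncens[OF G]\<close>)
    ultimately show "km_expectation Z' \<beta> ?g < b"
      by simp
  qed (rule K)
  then show thesis
    using K(1) that by blast
qed

lemma M_scale_uniformly_large:
  fixes Z :: "('n::finite, 'p::finite) sample"
  assumes q: "\<And>\<theta>. norm \<theta> = 1 \<Longrightarrow> card {i. \<theta> \<bullet> covar Z i = 0} \<le> q"
    and r: "real CARD('n) * b < (real CARD('n) - real q - real r) * a"
    and b: "0 < b" and L: "0 < L"
  obtains R where "0 \<le> R"
    and "\<And>Z' G \<beta> \<gamma>. kept r Z Z' G \<Longrightarrow> R < norm (\<beta> + \<gamma>) \<Longrightarrow> L \<le> M_scale \<rho> b Z' \<beta> \<gamma>"
proof -
  obtain c where c: "0 < c" and near: "\<And>\<theta>. norm \<theta> = 1 \<Longrightarrow> card {i. \<bar>\<theta> \<bullet> covar Z i\<bar> < c} \<le> q"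
    using few_covariates_near_hyperplane[of "covar Z" q] q by metis
  define Y where "Y = Max (range (\<lambda>i. \<bar>resp Z i\<bar>))"
  have Y: "\<bar>resp Z i\<bar> \<le> Y" for i
    unfolding Y_def by (intro Max_ge) auto
  have "0 \<le> Y"
    using Y abs_ge_zero order.trans by blast
  define N where "N = real CARD('n) - real q - real r"
  have "0 < N * a"
    using r b unfolding N_def[symmetric] by (meson mult_pos_pos of_nat_0_less_iff order.strict_trans zero_less_card_finite)
  then have "0 < N"
    using a_pos by (simp add: zero_less_mult_iff)
  \<comment> \<open>the loss level at which \<open>N\<close> observations of mass \<open>1 / n\<close> alone reach expectation \<open>b\<close>\<close>
  define d where "d = real CARD('n) * b / N"
  have "d < a"
    using r \<open>0 < N\<close> by (simp add: d_def N_def[symmetric] divide_less_eq mult.commute)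
  have "0 < d"
    using \<open>0 < N\<close> b by (simp add: d_def)
  obtain M where M: "0 \<le> M" "\<And>u. M \<le> \<bar>u\<bar> \<Longrightarrow> d < \<rho> u"
    using exceeds_below_sup[OF \<open>d < a\<close>] by metis
  \<comment> \<open>beyond \<open>R\<close> a covariate that is \<open>c\<close>-far from the hyperplane has a residual of size at least \<open>M * L\<close>\<close>
  define R where "R = (M * L + Y) / c"
  have "L \<le> M_scale \<rho> b Z' \<beta> \<gamma>" if G: "kept r Z Z' G" and big: "R < norm (\<beta> + \<gamma>)" for Z' G \<beta> \<gamma>
  proof (rule le_M_scale[OF b])
    fix s assume s: "0 < s" "s \<le> L"
    let ?g = "\<lambda>u x. \<rho> ((u - \<gamma> \<bullet> x) / s)"
    have "0 \<le> R"
      using c M(1) L \<open>0 \<le> Y\<close> by (simp add: R_def)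
    define \<eta> where "\<eta> = norm (\<beta> + \<gamma>)"
    have "0 < \<eta>"
      unfolding \<eta>_def using big \<open>0 \<le> R\<close> by linarith
    define \<theta> where "\<theta> = (1 / \<eta>) *\<^sub>R (\<beta> + \<gamma>)"
    have \<theta>: "norm \<theta> = 1" "\<beta> + \<gamma> = \<eta> *\<^sub>R \<theta>"
      unfolding \<theta>_def norm_scaleR using \<open>0 < \<eta>\<close> by (simp_all add: \<eta>_def[symmetric])
    define H where "H = G - {i. \<bar>\<theta> \<bullet> covar Z i\<bar> < c}"
    have "card G - card {i. \<bar>\<theta> \<bullet> covar Z i\<bar> < c} \<le> card H"
      unfolding H_def by (rule diff_card_le_card_Diff) simp
    moreover have "card {i. \<bar>\<theta> \<bullet> covar Z i\<bar> < c} \<le> q"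
      by (rule near) (rule \<theta>)
    moreover have "CARD('n) \<le> card G + r"
      using G by (simp add: kept_def)
    ultimately have "CARD('n) \<le> card H + q + r"
      by linarith
    then have "real CARD('n) \<le> real (card H + q + r)"
      by (simp only: of_nat_le_iff)
    then have "N \<le> real (card H)"
      by (simp add: N_def)
    have far: "d \<le> ?g (resid Z' \<beta> i) (covar Z' i)" if "i \<in> H" for i
    proof -
      have "i \<in> G" "c \<le> \<bar>\<theta> \<bullet> covar Z i\<bar>"
        using that by (auto simp: H_def)
      have "M * s \<le> M * L"
        using s M(1) by (intro mult_left_mono)
      also have "\<dots> \<le> c * \<eta> - Y"
        using big c by (simp add: R_def \<eta>_def divide_less_eq mult.commute)
      also have "\<dots> \<le> \<bar>\<theta> \<bullet> covar Z i\<bar> * \<eta> - \<bar>resp Z i\<bar>"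
        using \<open>c \<le> _\<close> \<open>0 < \<eta>\<close> Y[of i] by (intro diff_mono mult_right_mono) auto
      also have "\<dots> = \<bar>(\<beta> + \<gamma>) \<bullet> covar Z i\<bar> - \<bar>resp Z i\<bar>"
        using \<open>0 < \<eta>\<close> by (simp add: \<theta>(2) abs_mult)
      also have "\<dots> \<le> \<bar>resp Z i - (\<beta> + \<gamma>) \<bullet> covar Z i\<bar>"
        by simp
      finally have "M \<le> \<bar>(resp Z i - (\<beta> + \<gamma>) \<bullet> covar Z i) / s\<bar>"
        using s(1) by (simp add: pos_le_divide_eq)
      then show ?thesis
        unfolding kept_resid[OF G \<open>i \<in> G\<close>] using M(2) by (simp add: less_imp_le)
    qed
    have "real CARD('n) * b = N * d"
      using \<open>0 < N\<close> by (simp add: d_def)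
    also have "\<dots> \<le> real (card H) * d"
      using \<open>N \<le> _\<close> \<open>0 < d\<close> by simp
    also have "\<dots> \<le> (\<Sum>i\<in>H. ?g (resid Z' \<beta> i) (covar Z' i))"
      by (rule sum_bounded_below) (rule far)
    finally have "b \<le> (\<Sum>i\<in>H. ?g (resid Z' \<beta> i) (covar Z' i)) / real CARD('n)"
      by (simp add: le_divide_eq mult.commute)
    also have "\<dots> \<le> km_expectation Z' \<beta> ?g"
      by (rule uncens_sum_le_km_expectation) (auto simp: nonneg H_def kept_uncens[OF G])
    finally show "b \<le> km_expectation Z' \<beta> ?g" .
  qed
  moreover have "0 \<le> R"
    using c M(1) L \<open>0 \<le> Y\<close> by (simp add: R_def)
  ultimately show thesis
    using that by blast
qed

lemma gamma_hat_uniformly_close: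
  fixes Z :: "('n::finite, 'p::finite) sample"
  assumes q: "\<And>\<theta>. norm \<theta> = 1 \<Longrightarrow> card {i. \<theta> \<bullet> covar Z i = 0} \<le> q"
    and b: "0 < b"
    and r1: "real r * a < real CARD('n) * b"
    and r2: "real CARD('n) * b < (real CARD('n) - real q - real r) * a"
  obtains R where "0 \<le> R"
    and "\<And>Z' G \<beta> \<gamma>. kept r Z Z' G \<Longrightarrow> is_gamma_hat \<rho> b Z' \<beta> \<gamma> \<Longrightarrow> norm (\<beta> + \<gamma>) \<le> R"
proof -
  obtain K where K: "0 < K" "\<And>Z' G \<beta>. kept r Z Z' G \<Longrightarrow> M_scale \<rho> b Z' \<beta> (- \<beta>) \<le> K"
    using M_scale_uniformly_bounded[OF r1, of Z] by metis
  have "0 < K + 1"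
    using K(1) by simp
  then obtain R where R: "0 \<le> R"
    "\<And>Z' G \<beta> \<gamma>. kept r Z Z' G \<Longrightarrow> R < norm (\<beta> + \<gamma>) \<Longrightarrow> K + 1 \<le> M_scale \<rho> b Z' \<beta> \<gamma>"
    using M_scale_uniformly_large[OF q r2 b] by metis
  have "norm (\<beta> + \<gamma>) \<le> R" if G: "kept r Z Z' G" and \<gamma>: "is_gamma_hat \<rho> b Z' \<beta> \<gamma>" for Z' G \<beta> \<gamma>
  proof (rule ccontr)
    assume "\<not> norm (\<beta> + \<gamma>) \<le> R"
    then have "K + 1 \<le> M_scale \<rho> b Z' \<beta> \<gamma>"
      using R(2)[OF G] by simp
    also have "\<dots> \<le> M_scale \<rho> b Z' \<beta> (- \<beta>)"
      using \<gamma> by (auto simp: is_gamma_hat_def is_arg_min_def not_less)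
    also have "\<dots> \<le> K"
      by (rule K(2)[OF G])
    finally show False
      by simp
  qed
  then show thesis
    using R(1) that by blast
qed

end

text \<open>
  Comparison of the minimizer \<open>\<beta>\<close> with the competitor \<open>0\<close>: at \<open>0\<close> the hypothesis bounds \<open>\<gamma>\<close> itself,
  and the condition number \<open>hi / lo\<close> of the matrix transfers the bound to the \<open>\<gamma>\<close> belonging to \<open>\<beta>\<close>.
\<close>

lemma S_regression_min_norm_le:
  fixes Z :: "('n::finite, 'p::finite) sample" and A :: "('n \<Rightarrow> real ^ 'p) \<Rightarrow> real ^ 'p ^ 'p"
  assumes min: "is_S_regression_min \<rho> b A Z \<beta>"
    and R: "\<And>\<beta> \<gamma>. is_gamma_hat \<rho> b Z \<beta> \<gamma> \<Longrightarrow> norm (\<beta> + \<gamma>) \<le> R"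
    and sym: "transpose (A (covar Z)) = A (covar Z)"
    and eig: "\<And>l. eigenvalue (A (covar Z)) l \<Longrightarrow> lo \<le> l \<and> l \<le> hi"
    and lo: "0 < lo"
  shows "norm \<beta> \<le> R + sqrt (hi / lo) * R"
proof -
  let ?M = "A (covar Z)"
  obtain g where g: "\<And>\<beta>. is_gamma_hat \<rho> b Z \<beta> (g \<beta>)"
    and g_min: "g \<beta> \<bullet> (?M *v g \<beta>) \<le> g 0 \<bullet> (?M *v g 0)"
    using min by (auto simp: is_S_regression_min_def is_arg_min_def not_less)
  obtain l where "eigenvalue ?M l"
    using symmetric_matrix_least_eigenvalue[OF sym] by metis
  then have "0 < hi"
    using eig lo by fastforce
  have g0: "norm (g 0) \<le> R"
    using R[OF g[of 0]] by simp
  have "lo * (norm (g \<beta>))\<^sup>2 \<le> g \<beta> \<bullet> (?M *v g \<beta>)"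
    by (rule symmetric_matrix_quadratic_form_bounds(1)[OF sym eig])
  also have "\<dots> \<le> g 0 \<bullet> (?M *v g 0)"
    by (rule g_min)
  also have "\<dots> \<le> hi * (norm (g 0))\<^sup>2"
    by (rule symmetric_matrix_quadratic_form_bounds(2)[OF sym eig])
  also have "\<dots> \<le> hi * R\<^sup>2"
    using g0 \<open>0 < hi\<close> by (simp add: power_mono)
  finally have "(norm (g \<beta>))\<^sup>2 \<le> hi / lo * R\<^sup>2"
    using lo by (simp add: field_simps)
  then have "norm (g \<beta>) \<le> sqrt (hi / lo * R\<^sup>2)"
    by (rule real_le_rsqrt)
  also have "\<dots> = sqrt (hi / lo) * R"
    using order.trans[OF norm_ge_zero g0] by (simp only: real_sqrt_mult real_sqrt_abs abs_of_nonneg)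
  finally show ?thesis
    using R[OF g[of \<beta>]] norm_triangle_ineq4[of "\<beta> + g \<beta>" "g \<beta>"] by simp
qed


section \<open>The breakdown point\<close>

lemma breakdown_point_ge:
  fixes Z :: "('n::finite, 'p::finite) sample"
  assumes "\<And>k. real k < k0 \<Longrightarrow> \<exists>R. \<forall>Z'\<in>replacements k Z \<inter> D. norm (T Z') \<le> R"
  shows "ereal (k0 / real CARD('n)) \<le> breakdown_point D T Z"
  unfolding breakdown_point_def
proof (intro Inf_greatest, clarify)
  fix k
  assume sup: "(SUP Z'\<in>replacements k Z \<inter> D. ereal (norm (T Z' - T Z))) = \<infinity>"
  have "k0 \<le> real k"
  proof (rule ccontr)
    assume "\<not> k0 \<le> real k"
    then obtain R where R: "\<And>Z'. Z' \<in> replacements k Z \<inter> D \<Longrightarrow> norm (T Z') \<le> R"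
      using assms[of k] by auto
    have "norm (T Z' - T Z) \<le> R + norm (T Z)" if "Z' \<in> replacements k Z \<inter> D" for Z'
      using R[OF that] norm_triangle_ineq4[of "T Z'" "T Z"] by linarith
    then have "(SUP Z'\<in>replacements k Z \<inter> D. ereal (norm (T Z' - T Z))) \<le> ereal (R + norm (T Z))"
      by (intro SUP_least) simp
    with sup show False
      by simp
  qed
  then show "ereal (k0 / real CARD('n)) \<le> ereal (real k / real CARD('n))"
    by (simp add: divide_right_mono)
qed

theorem theorem2:
  fixes \<rho> :: "real \<Rightarrow> real"
    and a b k0 :: real
    and q m :: nat
    and Z :: "('n::finite, 'p::finite) sample"
    and D :: "('n, 'p) sample set"
    and T :: "('n, 'p) sample \<Rightarrow> real ^ 'p"
    and A :: "('n \<Rightarrow> real ^ 'p) \<Rightarrow> real ^ 'p ^ 'p"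
  assumes rho_nonneg: "\<And>u. 0 \<le> \<rho> u"
    and P1: "\<rho> 0 = 0" "isCont \<rho> 0"
    and P2: "\<And>u. u > 0 \<Longrightarrow> \<rho> (- u) = \<rho> u"
    and P3: "mono_on {0<..} \<rho>"
    and P4: "(SUP u. ereal (\<rho> u)) = ereal a" "0 < a"
    and b: "0 < b" "b < a"
    and rank: "dim (range (covar Z)) = CARD('p)"
    and q_def: "q = Max ((\<lambda>\<theta>. card {i. \<theta> \<bullet> covar Z i = 0}) ` {\<theta>. norm \<theta> = 1})"
    and m_def: "m = card {i. \<not> uncens Z i}"
    and k0_def: "k0 = min (real CARD('n) * (1 - b / a) - real q - real m)
                          (real CARD('n) * (b / a) - real m)"
    and Z_in_D: "Z \<in> D"
    and estimator:
      "(\<forall>Z' \<in> D. is_S_regression_zero \<rho> b Z' (T Z')) \<or>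
       (affine_equivariant A \<and> robust_covariance k0 Z A \<and>
        (\<forall>Z' \<in> D. is_S_regression_min \<rho> b A Z' (T Z')))"
  shows "breakdown_point D T Z \<ge> ereal (k0 / real CARD('n))"
proof (rule breakdown_point_ge)
  fix k
  assume k: "real k < k0"
  interpret bounded_loss \<rho> a
    by unfold_locales (fact rho_nonneg P1 P2 P3 P4)+
  \<comment> \<open>the counts are at most \<open>n\<close>, so \<open>q\<close> is the maximum of a finite set\<close>
  have "finite ((\<lambda>\<theta>. card {i. \<theta> \<bullet> covar Z i = 0}) ` {\<theta>. norm \<theta> = 1})"
    by (rule finite_subset[of _ "{..CARD('n)}"]) (auto intro: card_mono)
  then have q: "card {i. \<theta> \<bullet> covar Z i = 0} \<le> q" if "norm \<theta> = 1" for \<theta>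
    unfolding q_def using that by (intro Max_ge) auto
  have "real (k + m) < real CARD('n) * (b / a)"
    and "real (k + m) < real CARD('n) * (1 - b / a) - real q"
    using k by (auto simp: k0_def)
  then have r1: "real (k + m) * a < real CARD('n) * b"
    and r2: "real CARD('n) * b < (real CARD('n) - real q - real (k + m)) * a"
    using \<open>0 < a\<close> by (auto simp: field_simps)
  obtain R where R: "0 \<le> R" "\<And>Z' G \<beta> \<gamma>. kept (k + m) Z Z' G \<Longrightarrow> is_gamma_hat \<rho> b Z' \<beta> \<gamma>
      \<Longrightarrow> norm (\<beta> + \<gamma>) \<le> R"
    using gamma_hat_uniformly_close[OF q b(1) r1 r2] by metis
  have close: "norm (\<beta> + \<gamma>) \<le> R"
    if "Z' \<in> replacements k Z" "is_gamma_hat \<rho> b Z' \<beta> \<gamma>" for Z' \<beta> \<gamma>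
    using replacements_kept[OF that(1)] R(2) that(2) by (auto simp: m_def)
  show "\<exists>R. \<forall>Z'\<in>replacements k Z \<inter> D. norm (T Z') \<le> R"
    using estimator
  proof (elim disjE conjE)
    assume "\<forall>Z'\<in>D. is_S_regression_zero \<rho> b Z' (T Z')"
    then have "\<forall>Z'\<in>replacements k Z \<inter> D. norm (T Z') \<le> R"
      using close[where \<gamma> = 0] by (auto simp: is_S_regression_zero_def)
    then show ?thesis ..
  next
    assume A: "robust_covariance k0 Z A"
      and T: "\<forall>Z'\<in>D. is_S_regression_min \<rho> b A Z' (T Z')"
    obtain lo hi where lo: "0 < lo"
      and sym: "\<And>Z'. Z' \<in> replacements k Z \<Longrightarrow> transpose (A (covar Z')) = A (covar Z')"
      and eig: "\<And>Z' l. Z' \<in> replacements k Z \<Longrightarrow> eigenvalue (A (covar Z')) l \<Longrightarrow> lo \<le> l \<and> l \<le> hi"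
      using A k unfolding robust_covariance_def by meson
    have "norm (T Z') \<le> R + sqrt (hi / lo) * R" if "Z' \<in> replacements k Z \<inter> D" for Z'
    proof (rule S_regression_min_norm_le)
      show "is_S_regression_min \<rho> b A Z' (T Z')"
        using that T by simp
    qed (use that lo close sym eig in auto)
    then show ?thesis
      by blast
  qed
qed

end
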